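(* Let $r$ be a balanced rotor type and let $a\ge 0$, $b\ge 1$ be integers such that the runs $r^{(1)},\dots,r^{(2a)}$ and $r^{(2a+1)},\dots,r^{(2a+2b)}$ are balanced. Let $S_{UU}$ and $S_{DD}$ be the runs of the hitting sequences $UU(r)$ and $DD(r)$, respectively, formed by the targets hit by the $(2a+1)$-th through $(2a+2b)$-th particles to leave the source. If the run $r^{(a+1)},\dots,r^{(a+b)}$ is not constant, then $S_{UU}$ and $S_{DD}$ are both nonempty and balanced and their lengths add to $2b$. If the run $r^{(a+1)},\dots,r^{(a+b)}$ is constant, then exactly one of $S_{UU}$, $S_{DD}$ is nonempty, and it is balanced of length exactly $2b$.
   Context: A two-state rotor type is an infinite periodic sequence $r=(r^{(1)},r^{(2)},\dots)$ over $\{1,2\}$ (convention $r^{(1)}=1$); it is balanced if $1$ and $2$ occur equally often in a period. A run is a contiguous finite subsequence; a run is balanced if it contains equally many of each of the two states, and constant if all its terms are equal. Rotor-router dynamics: at each non-target vertex $v$ there is a periodic sequence $e_v^{(1)},e_v^{(2)},\dots$ of out-edges; a particle starts at the source, on its $j$-th visit to $v$ leaves along $e_v^{(j)}$, and whenever it reaches a target it is returned to the source; the hitting sequence is the sequence of targets reached. The particle is regarded as a new particle each time it leaves the source, so the $k$-th particle is the one leaving the source along the edge given by the $k$-th term of the source rotor. The compressor for $r$ has non-target vertices $1$ (source), $2,3$ and targets $4,5$. On the $j$-th departure: from vertex $1$ the particle goes to vertex $2$ if $r^{(j)}=1$ and to vertex $3$ if $r^{(j)}=2$; from vertex $2$,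 in variant $U$ it goes to vertex $1$ if $r^{(j)}=1$ and to target $4$ if $r^{(j)}=2$, in variant $D$ to target $4$ if $r^{(j)}=1$ and to vertex $1$ if $r^{(j)}=2$; from vertex $3$ likewise with target $5$. $UU(r)$ (resp. $DD(r)$) is the hitting sequence with variant $U$ (resp. $D$) at both vertices $2$ and $3$; a run of it is balanced if it contains equally many $4$'s and $5$'s. *)

theory Defs
  imports Main "HOL-Library.Infinite_Set"
begin

text \<open>Rotor sequences are functions on \<open>nat\<close> indexed from 1; their value at 0 is never used.\<close>

definition run :: "(nat \<Rightarrow> 'a) \<Rightarrow> nat \<Rightarrow> nat \<Rightarrow> 'a list" where
  "run f m n = map f [m..<Suc n]"

definition balanced_in :: "'a \<Rightarrow> 'a \<Rightarrow> 'a list \<Rightarrow> bool" where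
  "balanced_in x y xs \<longleftrightarrow> count_list xs x = count_list xs y"

definition constant_run :: "'a list \<Rightarrow> bool" where
  "constant_run xs \<longleftrightarrow> (\<forall>x\<in>set xs. \<forall>y\<in>set xs. x = y)"

definition is_period :: "nat \<Rightarrow> (nat \<Rightarrow> 'a) \<Rightarrow> bool" where
  "is_period p f \<longleftrightarrow> p \<ge> 1 \<and> (\<forall>j\<ge>1. f (j + p) = f j)"

definition two_state_rotor_type :: "(nat \<Rightarrow> nat) \<Rightarrow> bool" where
  "two_state_rotor_type r \<longleftrightarrow>
     (\<forall>j\<ge>1. r j \<in> {1, 2}) \<and> (\<exists>p. is_period p r) \<and> r 1 = 1"

text \<open>Whether the two states are equally frequent does not depend on the choice of the period.\<close>

definition balanced_rotor_type :: "(nat \<Rightarrow> nat) \<Rightarrow> bool" where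
  "balanced_rotor_type r \<longleftrightarrow>
     two_state_rotor_type r \<and> (\<exists>p. is_period p r \<and> balanced_in 1 2 (run r 1 p))"


text \<open>Rotor-router dynamics with source \<open>s\<close>, target set \<open>T\<close> and rotors \<open>e\<close>, where \<open>e v j\<close> is the
  head of the edge used at the \<open>j\<close>-th departure from \<open>v\<close>. A state consists of the position of the
  particle and the number of departures so far from each vertex. Returning from a target to the
  source takes one time step and is not counted as a departure.\<close>

definition rotor_step ::
    "('v \<Rightarrow> nat \<Rightarrow> 'v) \<Rightarrow> 'v \<Rightarrow> 'v set \<Rightarrow> 'v \<times> ('v \<Rightarrow> nat) \<Rightarrow> 'v \<times> ('v \<Rightarrow> nat)" where
  "rotor_step e s T = (\<lambda>(v, c).
     if v \<in> T then (s, c) else (e v (Suc (c v)), c(v := Suc (c v))))"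

definition rotor_state :: "('v \<Rightarrow> nat \<Rightarrow> 'v) \<Rightarrow> 'v \<Rightarrow> 'v set \<Rightarrow> nat \<Rightarrow> 'v \<times> ('v \<Rightarrow> nat)" where
  "rotor_state e s T t = (rotor_step e s T ^^ t) (s, \<lambda>_. 0)"

definition position :: "('v \<Rightarrow> nat \<Rightarrow> 'v) \<Rightarrow> 'v \<Rightarrow> 'v set \<Rightarrow> nat \<Rightarrow> 'v" where
  "position e s T t = fst (rotor_state e s T t)"

text \<open>Every departure from the source starts a new particle, so the particle that is moving at time
  \<open>t\<close> has as its number the number of departures from the source before time \<open>t\<close>.\<close>

definition particle :: "('v \<Rightarrow> nat \<Rightarrow> 'v) \<Rightarrow> 'v \<Rightarrow> 'v set \<Rightarrow> nat \<Rightarrow> nat" where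
  "particle e s T t = snd (rotor_state e s T t) s"

text \<open>The times at which targets are hit are enumerated in increasing order, starting from index 0
  (\<open>enumerate\<close> is meaningful here when there are infinitely many of them, which is the case for the
  compressors of a balanced rotor type).\<close>

definition hitting_time :: "('v \<Rightarrow> nat \<Rightarrow> 'v) \<Rightarrow> 'v \<Rightarrow> 'v set \<Rightarrow> nat \<Rightarrow> nat" where
  "hitting_time e s T = enumerate {t. position e s T t \<in> T}"

definition hitting_sequence :: "('v \<Rightarrow> nat \<Rightarrow> 'v) \<Rightarrow> 'v \<Rightarrow> 'v set \<Rightarrow> nat \<Rightarrow> 'v" where
  "hitting_sequence e s T i = position e s T (hitting_time e s T i)"

text \<open>The indices of the terms of the hitting sequence contributed by the particles numbered \<open>k\<close> to
  \<open>l\<close>. The particle number is nondecreasing in time, so they are consecutive. The index set is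
  finite whenever the particle leaves the source infinitely often, as it does in a compressor.\<close>

definition hit_indices ::
    "('v \<Rightarrow> nat \<Rightarrow> 'v) \<Rightarrow> 'v \<Rightarrow> 'v set \<Rightarrow> nat \<Rightarrow> nat \<Rightarrow> nat list" where
  "hit_indices e s T k l =
     sorted_list_of_set {i. particle e s T (hitting_time e s T i) \<in> {k..l}}"


datatype vertex = V1 | V2 | V3 | V4 | V5

datatype variant = U | D

definition variant_move :: "variant \<Rightarrow> vertex \<Rightarrow> nat \<Rightarrow> vertex" where
  "variant_move x t q = (case x of
     U \<Rightarrow> if q = 1 then V1 else t
   | D \<Rightarrow> if q = 1 then t else V1)"

text \<open>The values at the targets \<open>V4\<close> and \<open>V5\<close> are never used.\<close>

fun compressor :: "variant \<Rightarrow> variant \<Rightarrow> (nat \<Rightarrow> nat) \<Rightarrow> vertex \<Rightarrow> nat \<Rightarrow> vertex" where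
  "compressor x y r V1 j = (if r j = 1 then V2 else V3)"
| "compressor x y r V2 j = variant_move x V4 (r j)"
| "compressor x y r V3 j = variant_move y V5 (r j)"
| "compressor x y r V4 j = V1"
| "compressor x y r V5 j = V1"

text \<open>The hitting sequences \<open>UU(r)\<close> and \<open>DD(r)\<close>, and their runs formed by the targets hit by the
  particles numbered \<open>k\<close> to \<open>l\<close>.\<close>

definition UU :: "(nat \<Rightarrow> nat) \<Rightarrow> nat \<Rightarrow> vertex" where
  "UU r = hitting_sequence (compressor U U r) V1 {V4, V5}"

definition DD :: "(nat \<Rightarrow> nat) \<Rightarrow> nat \<Rightarrow> vertex" where
  "DD r = hitting_sequence (compressor D D r) V1 {V4, V5}"

definition UU_run :: "(nat \<Rightarrow> nat) \<Rightarrow> nat \<Rightarrow> nat \<Rightarrow> vertex list" where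
  "UU_run r k l = map (UU r) (hit_indices (compressor U U r) V1 {V4, V5} k l)"

definition DD_run :: "(nat \<Rightarrow> nat) \<Rightarrow> nat \<Rightarrow> nat \<Rightarrow> vertex list" where
  "DD_run r k l = map (DD r) (hit_indices (compressor D D r) V1 {V4, V5} k l)"

end

theory Submission
  imports Defs
begin

text \<open>The \<open>k\<close>-th particle visits exactly one of the vertices 2 and 3, and this visit uses the term of
  the rotor of that vertex whose index is the number of occurrences of \<open>r k\<close> among
  \<open>r 1, \<dots>, r k\<close>. By the balance assumptions the particles \<open>2a + 1\<close> to \<open>2a + 2b\<close> use precisely the
  terms \<open>a + 1\<close> to \<open>a + b\<close> at each of the two vertices. So each of the two targets is hit once for
  every 2 among these terms in \<open>UU r\<close>, and once for every 1 in \<open>DD r\<close>.\<close>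

section \<open>Cardinalities of filtered intervals and enumerated sets\<close>

lemma count_list_map_distinct:
  assumes "distinct xs"
  shows "count_list (map f xs) y = card {x \<in> set xs. f x = y}"
  using assms
proof (induction xs)
  case (Cons z zs)
  have "{x \<in> set (z # zs). f x = y} =
      (if f z = y then insert z {x \<in> set zs. f x = y} else {x \<in> set zs. f x = y})"
    by auto
  with Cons show ?case by auto
qed simp

lemma count_list_run: "count_list (run f m n) y = card {j \<in> {m..n}. f j = y}"
  by (simp add: run_def count_list_map_distinct atLeastLessThanSuc_atLeastAtMost del: upt_Suc)

lemma card_Collect_atLeastAtMost_Suc:
  assumes "m \<le> Suc n"
  shows "card {j \<in> {m..Suc n}. P j} = card {j \<in> {m..n}. P j} + of_bool (P (Suc n))"
proof -
  have "{j \<in> {m..Suc n}. P j} =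
      (if P (Suc n) then insert (Suc n) {j \<in> {m..n}. P j} else {j \<in> {m..n}. P j})"
    using assms by (auto simp: le_Suc_eq)
  then show ?thesis by simp
qed

lemma card_Collect_atLeastAtMost_append:
  assumes "m \<le> n"
  shows "card {j \<in> {1..n}. P j} = card {j \<in> {1..m}. P j} + card {j \<in> {Suc m..n}. P j}"
  using assms
  by (induction n rule: dec_induct)
    (simp_all add: card_Collect_atLeastAtMost_Suc del: atLeastAtMost_iff)

text \<open>\<open>enumerate A\<close> is a bijection from the naturals onto the infinite set
  \<open>A\<close>. This later turns counting indices of the hitting sequence into counting hitting
  times.\<close>

lemma card_enumerate_vimage:
  fixes A :: "nat set"
  assumes "infinite A"
  shows "card {i. P (enumerate A i)} = card {t \<in> A. P t}"
    and "finite {i. P (enumerate A i)} \<longleftrightarrow> finite {t \<in> A. P t}"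
proof -
  have "bij_betw (enumerate A) {i. P (enumerate A i)} {t \<in> A. P t}"
    using bij_enumerate[OF assms] by (fastforce simp: bij_betw_def inj_on_def image_iff)
  then show "card {i. P (enumerate A i)} = card {t \<in> A. P t}"
    and "finite {i. P (enumerate A i)} \<longleftrightarrow> finite {t \<in> A. P t}"
    by (rule bij_betw_same_card, rule bij_betw_finite)
qed

section \<open>Recurrence of both rotor states\<close>

lemma periodic_infinitely_often:
  assumes "is_period p f" and "j \<ge> 1" and "f j = y"
  shows "infinite {i. i \<ge> 1 \<and> f i = y}"
proof
  assume fin: "finite {i. i \<ge> 1 \<and> f i = y}"
  have "f (j + k * p) = y" for k
  proof (induction k)
    case (Suc k)
    have "f ((j + k * p) + p) = f (j + k * p)"
      using assms(1,2) by (simp add: is_period_def)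
    with Suc show ?case by (simp add: algebra_simps)
  qed (use assms in simp)
  then have "range (\<lambda>k. j + k * p) \<subseteq> {i. i \<ge> 1 \<and> f i = y}"
    using assms(2) by auto
  moreover have "inj (\<lambda>k. j + k * p)"
    using assms(1) by (auto simp: inj_on_def is_period_def)
  ultimately show False
    using fin finite_imageD infinite_UNIV_nat finite_subset by blast
qed

text \<open>State 1 occurs in a balanced period because \<open>r 1 = 1\<close>; balance then forces
  state 2 to occur as well, and periodicity repeats both.\<close>

lemma balanced_rotor_type_infinitely_often:
  assumes "balanced_rotor_type r" and "s \<in> {1, 2}"
  shows "infinite {i. i \<ge> 1 \<and> r i = s}"
proof -
  obtain p where p: "is_period p r" and bal: "balanced_in 1 2 (run r 1 p)" and r1: "r 1 = 1"
    using assms(1) by (auto simp: balanced_rotor_type_def two_state_rotor_type_def)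
  let ?A = "\<lambda>q. {j \<in> {1..p}. r j = q}"
  have "1 \<in> ?A 1"
    using p r1 by (simp add: is_period_def)
  then have "card (?A 1) \<noteq> 0"
    by (subst card_0_eq) (simp, blast)
  moreover have "card (?A 1) = card (?A 2)"
    using bal by (simp only: balanced_in_def count_list_run)
  ultimately have "card (?A s) \<noteq> 0"
    using assms(2) by (metis empty_iff insert_iff)
  then have "?A s \<noteq> {}"
    by (metis card.empty)
  then obtain j where "j \<ge> 1" "r j = s"
    by (auto simp del: One_nat_def)
  then show ?thesis using periodic_infinitely_often[OF p] by blast
qed

section \<open>Visits to vertices 2 and 3\<close>

text \<open>The Boolean argument \<open>s\<close> selects a side of the compressor: \<open>True\<close> stands for vertex 2 and
  target 4, \<open>False\<close> for vertex 3 and target 5.\<close>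

definition side_target :: "bool \<Rightarrow> vertex" where
  "side_target s = (if s then V4 else V5)"

definition visits :: "(nat \<Rightarrow> nat) \<Rightarrow> bool \<Rightarrow> nat \<Rightarrow> nat" where
  "visits r s k = card {j \<in> {1..k}. (r j = 1) = s}"

definition exits :: "variant \<Rightarrow> nat \<Rightarrow> bool" where
  "exits x q \<longleftrightarrow> (q = 1) = (x = D)"

text \<open>Particle \<open>k\<close> is included in its own visit count, so
  \<open>visits r (r k = 1) k\<close> is the index of the rotor term that decides whether it
  exits.\<close>

definition hits :: "variant \<Rightarrow> (nat \<Rightarrow> nat) \<Rightarrow> nat \<Rightarrow> bool" where
  "hits x r k \<longleftrightarrow> exits x (r (visits r (r k = 1) k))"

lemma visits_0 [simp]: "visits r s 0 = 0"
  by (simp add: visits_def)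

lemma visits_Suc: "visits r s (Suc k) = visits r s k + of_bool ((r (Suc k) = 1) = s)"
  unfolding visits_def by (rule card_Collect_atLeastAtMost_Suc) simp

lemma visits_mono: "m \<le> n \<Longrightarrow> visits r s m \<le> visits r s n"
  unfolding visits_def by (intro card_mono) auto

text \<open>The visit count starts at 0, grows by steps of at most 1 and is unbounded, so it attains
  \<open>i\<close>; the least place where it does so is a visit on side \<open>s\<close>.\<close>

lemma visits_surj:
  assumes "infinite {j. j \<ge> 1 \<and> (r j = 1) = s}" and "i \<ge> 1"
  obtains j where "j \<ge> 1" "(r j = 1) = s" "visits r s j = i"
proof -
  obtain B where B: "finite B" "card B = i" "B \<subseteq> {j. j \<ge> 1 \<and> (r j = 1) = s}"
    using infinite_arbitrarily_large[OF assms(1)] by metis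
  have "card B \<le> visits r s (Max B)"
    unfolding visits_def using B by (intro card_mono) auto
  then have ex: "\<exists>n. i \<le> visits r s n" using B by auto
  define j where "j = (LEAST n. i \<le> visits r s n)"
  have j: "i \<le> visits r s j"
    unfolding j_def using ex by (rule LeastI_ex)
  obtain k where k: "j = Suc k"
    using j assms(2) by (cases j) auto
  have "visits r s k < i"
    using not_less_Least[of k "\<lambda>n. i \<le> visits r s n"] k by (simp add: j_def)
  with j have "(r j = 1) = s" "visits r s j = i"
    by (cases "(r j = 1) = s"; simp add: k visits_Suc)+
  with that k show ?thesis by auto
qed

text \<open>Successive particles on side \<open>s\<close> use successive rotor terms, each exactly
  once. Counting particles thus becomes counting terms in a window.\<close>

lemma card_visits:
  assumes "m \<le> n"
  shows "card {j \<in> {Suc m..n}. (r j = 1) = s \<and> Q (visits r s j)}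
       = card {i \<in> {Suc (visits r s m)..visits r s n}. Q i}"
  using assms
proof (induction n rule: dec_induct)
  case (step n)
  have "visits r s m \<le> visits r s n" using step by (simp add: visits_mono)
  then show ?case
    using step by (cases "(r (Suc n) = 1) = s")
      (simp_all add: card_Collect_atLeastAtMost_Suc visits_Suc del: atLeastAtMost_iff)
qed simp

lemma balanced_imp_visits:
  assumes "\<forall>j\<ge>1. r j \<in> {1, 2}" and "balanced_in 1 2 (run r 1 (2 * n))"
  shows "visits r s (2 * n) = n"
proof -
  let ?A = "\<lambda>q. {j \<in> {1..2 * n}. r j = q}"
  have "card (?A 1) + card (?A 2) = card (?A 1 \<union> ?A 2)"
    by (subst card_Un_disjoint) auto
  also have "?A 1 \<union> ?A 2 = {1..2 * n}" using assms(1) by auto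
  finally have "card (?A 1) = n" "card (?A 2) = n"
    using assms(2) by (auto simp: balanced_in_def count_list_run)
  moreover have "(r j = 1) = s \<longleftrightarrow> r j = (if s then 1 else 2)" if "j \<ge> 1" for j
    using assms(1)[rule_format, OF that] by auto
  then have "{j \<in> {1..2 * n}. (r j = 1) = s} = ?A (if s then 1 else 2)"
    by auto
  ultimately show ?thesis by (simp add: visits_def)
qed

section \<open>Trajectory of the particle in the compressor\<close>

abbreviation compressor_state ::
    "variant \<Rightarrow> (nat \<Rightarrow> nat) \<Rightarrow> nat \<Rightarrow> vertex \<times> (vertex \<Rightarrow> nat)" where
  "compressor_state x r \<equiv> rotor_state (compressor x x r) V1 {V4, V5}"

abbreviation compressor_position :: "variant \<Rightarrow> (nat \<Rightarrow> nat) \<Rightarrow> nat \<Rightarrow> vertex" where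
  "compressor_position x r \<equiv> position (compressor x x r) V1 {V4, V5}"

abbreviation compressor_particle :: "variant \<Rightarrow> (nat \<Rightarrow> nat) \<Rightarrow> nat \<Rightarrow> nat" where
  "compressor_particle x r \<equiv> particle (compressor x x r) V1 {V4, V5}"

text \<open>The time at which particle \<open>k + 1\<close> is about to leave the source.\<close>

fun start_time :: "variant \<Rightarrow> (nat \<Rightarrow> nat) \<Rightarrow> nat \<Rightarrow> nat" where
  "start_time x r 0 = 0"
| "start_time x r (Suc k) = start_time x r k + (if hits x r (Suc k) then 3 else 2)"

text \<open>Closed form of the departure counts just before particle \<open>k + 1\<close> leaves.
  The targets get 0 because \<open>rotor_step\<close> counts no departure there.\<close>

definition departures :: "(nat \<Rightarrow> nat) \<Rightarrow> nat \<Rightarrow> vertex \<Rightarrow> nat" where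
  "departures r k v = (case v of V1 \<Rightarrow> k | V2 \<Rightarrow> visits r True k | V3 \<Rightarrow> visits r False k | _ \<Rightarrow> 0)"

lemma strict_mono_start_time: "strict_mono (start_time x r)"
  by (simp add: strict_mono_Suc_iff)

lemma variant_move_eq: "variant_move x t q = (if exits x q then t else V1)"
  by (cases x) (auto simp: variant_move_def exits_def)

lemma rotor_state_Suc: "rotor_state e s T (Suc t) = rotor_step e s T (rotor_state e s T t)"
  by (simp add: rotor_state_def)

lemma departures_Suc:
  "departures r (Suc k) = (departures r k)
     (V1 := Suc k,
      (if r (Suc k) = 1 then V2 else V3) := visits r (r (Suc k) = 1) (Suc k))"
  by (rule ext) (auto simp: departures_def visits_Suc split: vertex.split)

lemma
  assumes "compressor_state x r t = (V1, departures r k)"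
  shows compressor_state_one:
      "compressor_state x r (Suc t) =
         (if r (Suc k) = 1 then V2 else V3, (departures r k)(V1 := Suc k))"
    and compressor_state_two:
      "compressor_state x r (Suc (Suc t)) =
         (if hits x r (Suc k) then side_target (r (Suc k) = 1) else V1, departures r (Suc k))"
proof -
  show one: "compressor_state x r (Suc t) =
      (if r (Suc k) = 1 then V2 else V3, (departures r k)(V1 := Suc k))"
    unfolding rotor_state_Suc[of _ _ _ t] assms by (simp add: rotor_step_def departures_def)
  show "compressor_state x r (Suc (Suc t)) =
      (if hits x r (Suc k) then side_target (r (Suc k) = 1) else V1, departures r (Suc k))"
    unfolding rotor_state_Suc[of _ _ _ "Suc t"] one departures_Suc
    by (auto simp: rotor_step_def departures_def visits_Suc variant_move_eq hits_def side_target_def)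
qed

text \<open>Two steps bring a particle back to the source or to a target. In the latter case the
  third step of the round is the return, which leaves the counts unchanged.\<close>

lemma compressor_state_start_time:
  "compressor_state x r (start_time x r k) = (V1, departures r k)"
proof (induction k)
  case 0
  show ?case
    by (auto simp: rotor_state_def departures_def split: vertex.split)
next
  case (Suc k)
  from compressor_state_two[OF Suc] show ?case
    by (auto simp: numeral_3_eq_3 rotor_state_Suc[of _ _ _ "Suc (Suc _)"] rotor_step_def side_target_def)
qed

text \<open>The start times cut time into rounds, one per particle. Within a round the particle can
  be at a target only at offset 2.\<close>

lemma compressor_position_eq_target_iff:
  "compressor_position x r t = side_target s \<longleftrightarrow>
     (\<exists>k. t = start_time x r k + 2 \<and> (r (Suc k) = 1) = s \<and> hits x r (Suc k))"
proof
  assume pos: "compressor_position x r t = side_target s"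
  have "\<exists>k. start_time x r k \<le> t \<and> t < start_time x r (Suc k)"
  proof (induction t)
    case 0
    show ?case by (rule exI[of _ 0]) simp
  next
    case (Suc t)
    then obtain k where k: "start_time x r k \<le> t" "t < start_time x r (Suc k)" by blast
    show ?case
    proof (cases "Suc t < start_time x r (Suc k)")
      case False
      then have "Suc t = start_time x r (Suc k)" using k by simp
      then show ?thesis
        using strict_monoD[OF strict_mono_start_time, of "Suc k" "Suc (Suc k)"] by (metis lessI order_refl)
    qed (use k in \<open>auto intro!: exI[of _ k]\<close>)
  qed
  then obtain k where k: "start_time x r k \<le> t" "t < start_time x r (Suc k)" by blast
  note st = compressor_state_start_time[of x r k]
  \<comment> \<open>Offset 2 belongs to the round only if its length is 3, that is, if the particle
    hits a target.\<close>
  consider "t = start_time x r k" | "t = Suc (start_time x r k)"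
    | "t = Suc (Suc (start_time x r k))" "hits x r (Suc k)"
    using k by (fastforce split: if_splits)
  then show "\<exists>k. t = start_time x r k + 2 \<and> (r (Suc k) = 1) = s \<and> hits x r (Suc k)"
  proof cases
    case 1
    with pos st show ?thesis by (simp add: position_def side_target_def split: if_splits)
  next
    case 2
    with pos compressor_state_one[OF st] show ?thesis
      by (simp add: position_def side_target_def split: if_splits)
  next
    case 3
    with pos compressor_state_two[OF st] show ?thesis
      by (intro exI[of _ k]) (simp add: position_def side_target_def split: if_splits)
  qed
next
  assume "\<exists>k. t = start_time x r k + 2 \<and> (r (Suc k) = 1) = s \<and> hits x r (Suc k)"
  then show "compressor_position x r t = side_target s"
    using compressor_state_two[OF compressor_state_start_time] by (auto simp: position_def)
qed

section \<open>Counting the hits of each target\<close>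

lemma compressor_particle_at_hit: "compressor_particle x r (start_time x r k + 2) = Suc k"
  using compressor_state_two[OF compressor_state_start_time, of x r k]
  by (simp add: particle_def departures_def)

text \<open>Hits on side \<open>s\<close> correspond one-to-one to the exiting particles on that
  side, and \<open>card_visits\<close> replaces these particles by the rotor terms they use.\<close>

lemma
  assumes "m \<le> n"
  shows finite_target_times:
      "finite {t. compressor_position x r t = side_target s \<and> compressor_particle x r t \<in> {Suc m..n}}"
    and card_target_times:
      "card {t. compressor_position x r t = side_target s \<and> compressor_particle x r t \<in> {Suc m..n}}
         = card {i \<in> {Suc (visits r s m)..visits r s n}. exits x (r i)}"
proof -
  let ?S = "{t. compressor_position x r t = side_target s \<and> compressor_particle x r t \<in> {Suc m..n}}"
  let ?J = "{j \<in> {Suc m..n}. (r j = 1) = s \<and> exits x (r (visits r s j))}"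
  \<comment> \<open>Particle \<open>j\<close> leaves the source at
    \<open>start_time x r (j - 1)\<close>, so a hit by it happens two steps later.\<close>
  let ?h = "\<lambda>j. start_time x r (j - 1) + 2"
  have "?S = ?h ` ?J"
  proof (intro set_eqI iffI)
    fix t assume t: "t \<in> ?S"
    then obtain k where "t = start_time x r k + 2" "(r (Suc k) = 1) = s" "hits x r (Suc k)"
      by (auto simp: compressor_position_eq_target_iff)
    with t show "t \<in> ?h ` ?J"
      by (intro image_eqI[of _ _ "Suc k"])
        (auto simp: hits_def compressor_particle_at_hit simp del: add_2_eq_Suc')
  next
    fix t assume "t \<in> ?h ` ?J"
    then obtain k where "t = start_time x r k + 2" "Suc k \<in> ?J"
      by (auto simp: Suc_le_eq gr0_conv_Suc dest!: less_imp_Suc_add)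
    then show "t \<in> ?S"
      by (auto simp: compressor_position_eq_target_iff hits_def compressor_particle_at_hit
          simp del: add_2_eq_Suc')
  qed
  moreover have "inj_on ?h ?J"
    using strict_mono_eq[OF strict_mono_start_time] by (auto simp: inj_on_def)
  ultimately show "finite ?S" "card ?S = card {i \<in> {Suc (visits r s m)..visits r s n}. exits x (r i)}"
    using card_visits[OF assms] by (simp_all add: card_image)
qed

text \<open>Vertex 2 alone suffices: all its rotor terms get used, and the exit state recurs among
  them. Infinitude is what makes \<open>enumerate\<close> meaningful for hitting times.\<close>

lemma infinite_hitting_times:
  assumes "balanced_rotor_type r"
  shows "infinite {t. compressor_position x r t \<in> {V4, V5}}"
proof
  assume fin: "finite {t. compressor_position x r t \<in> {V4, V5}}"
  let ?K = "{k. r (Suc k) = 1 \<and> hits x r (Suc k)}"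
  have "(\<lambda>k. start_time x r k + 2) ` ?K \<subseteq> {t. compressor_position x r t \<in> {V4, V5}}"
    using compressor_position_eq_target_iff[of x r _ True] by (fastforce simp: side_target_def)
  moreover have "inj_on (\<lambda>k. start_time x r k + 2) ?K"
    using strict_mono_eq[OF strict_mono_start_time] by (auto simp: inj_on_def)
  ultimately have "finite ?K"
    using fin finite_imageD finite_subset by blast
  \<comment> \<open>The left side collects the indices of the exit state, 1 for \<open>D\<close> and
    2 for \<open>U\<close>; each is the visit number of some hitting particle.\<close>
  moreover have "{i. i \<ge> 1 \<and> r i = (if x = D then 1 else 2)} \<subseteq> (\<lambda>k. visits r True (Suc k)) ` ?K"
  proof
    fix i assume i: "i \<in> {i. i \<ge> 1 \<and> r i = (if x = D then 1 else 2)}"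
    have "infinite {j. j \<ge> 1 \<and> (r j = 1) = True}"
      using balanced_rotor_type_infinitely_often[OF assms, of 1] by simp
    then obtain j where "j \<ge> 1" "r j = 1" "visits r True j = i"
      using visits_surj[of r True i] i by auto
    with i show "i \<in> (\<lambda>k. visits r True (Suc k)) ` ?K"
      by (intro image_eqI[of _ _ "j - 1"]) (auto simp: hits_def exits_def)
  qed
  ultimately show False
    using balanced_rotor_type_infinitely_often[OF assms, of "if x = D then 1 else 2"] finite_surj
    by (cases "x = D") (simp_all, blast+)
qed

text \<open>Common form of \<open>UU_run\<close> and \<open>DD_run\<close>, which lets both variants
  be treated at once.\<close>

definition hitting_run :: "variant \<Rightarrow> (nat \<Rightarrow> nat) \<Rightarrow> nat \<Rightarrow> nat \<Rightarrow> vertex list" where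
  "hitting_run x r k l =
     map (hitting_sequence (compressor x x r) V1 {V4, V5})
       (hit_indices (compressor x x r) V1 {V4, V5} k l)"

lemma
  assumes "balanced_rotor_type r" and "m \<le> n"
  shows count_list_hitting_run:
      "count_list (hitting_run x r (Suc m) n) (side_target s)
         = card {i \<in> {Suc (visits r s m)..visits r s n}. exits x (r i)}"
    and set_hitting_run: "set (hitting_run x r (Suc m) n) \<subseteq> {V4, V5}"
proof -
  let ?A = "{t. compressor_position x r t \<in> {V4, V5}}"
  let ?I = "{i. compressor_particle x r (enumerate ?A i) \<in> {Suc m..n}}"
  note inf = infinite_hitting_times[OF assms(1), of x]
  have target: "side_target s \<in> {V4, V5}" for s by (simp add: side_target_def)
  have "{t \<in> ?A. compressor_particle x r t \<in> {Suc m..n}} \<subseteq>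
      (\<Union>s. {t. compressor_position x r t = side_target s \<and> compressor_particle x r t \<in> {Suc m..n}})"
    by (auto simp: side_target_def UNIV_bool)
  then have "finite {t \<in> ?A. compressor_particle x r t \<in> {Suc m..n}}"
    by (rule finite_subset) (intro finite_UN_I finite_target_times[OF assms(2)] finite_UNIV)
  \<comment> \<open>\<open>sorted_list_of_set\<close> lists the elements of its argument only if
    that set is finite.\<close>
  then have fin: "finite ?I"
    by (simp only: card_enumerate_vimage(2)[OF inf, of "\<lambda>t. compressor_particle x r t \<in> {Suc m..n}"])
  have run: "hitting_run x r (Suc m) n =
      map (\<lambda>i. compressor_position x r (enumerate ?A i)) (sorted_list_of_set ?I)"
    by (simp add: hitting_run_def hit_indices_def hitting_sequence_def hitting_time_def)
  have "count_list (hitting_run x r (Suc m) n) (side_target s) =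
      card {i. compressor_particle x r (enumerate ?A i) \<in> {Suc m..n} \<and>
        compressor_position x r (enumerate ?A i) = side_target s}"
    unfolding run using fin by (subst count_list_map_distinct) simp_all
  also have "\<dots> = card {t \<in> ?A. compressor_particle x r t \<in> {Suc m..n} \<and>
        compressor_position x r t = side_target s}"
    by (rule card_enumerate_vimage(1)[OF inf])
  also have "{t \<in> ?A. compressor_particle x r t \<in> {Suc m..n} \<and>
        compressor_position x r t = side_target s} =
      {t. compressor_position x r t = side_target s \<and> compressor_particle x r t \<in> {Suc m..n}}"
    using target[of s] by auto
  finally show "count_list (hitting_run x r (Suc m) n) (side_target s)
      = card {i \<in> {Suc (visits r s m)..visits r s n}. exits x (r i)}"
    by (simp only: card_target_times[OF assms(2)])
  show "set (hitting_run x r (Suc m) n) \<subseteq> {V4, V5}"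
    unfolding run using fin enumerate_in_set[OF inf] by auto
qed

text \<open>Vertices 2 and 3 read the same window \<open>a + 1..a + b\<close> of the same sequence,
  so their targets are hit equally often.\<close>

lemma hitting_run_balanced:
  assumes "balanced_rotor_type r" and "m \<le> n"
    and "\<And>s. visits r s m = a" and "\<And>s. visits r s n = a + b"
  shows "balanced_in V4 V5 (hitting_run x r (Suc m) n)"
    and "length (hitting_run x r (Suc m) n) = 2 * card {i \<in> {a + 1..a + b}. exits x (r i)}"
proof -
  let ?L = "hitting_run x r (Suc m) n"
  have cnt: "count_list ?L V4 = card {i \<in> {a + 1..a + b}. exits x (r i)}"
      "count_list ?L V5 = card {i \<in> {a + 1..a + b}. exits x (r i)}"
    using count_list_hitting_run[OF assms(1,2), of x True] count_list_hitting_run[OF assms(1,2), of x False]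
    by (simp_all add: side_target_def assms(3,4))
  then show "balanced_in V4 V5 ?L" by (simp add: balanced_in_def)
  \<comment> \<open>No vertex other than the two targets occurs in the run, so the two counts
    exhaust its length.\<close>
  have "length ?L = (\<Sum>v\<in>{V4, V5}. count_list ?L v)"
    using sum_count_set[OF set_hitting_run[OF assms(1,2), of x]] by simp
  with cnt show "length ?L = 2 * card {i \<in> {a + 1..a + b}. exits x (r i)}" by simp
qed

theorem theorem7p7:
  fixes r :: "nat \<Rightarrow> nat" and a b :: nat
  assumes "balanced_rotor_type r"
    and "b \<ge> 1"
    and "balanced_in 1 2 (run r 1 (2 * a))"
    and "balanced_in 1 2 (run r (2 * a + 1) (2 * a + 2 * b))"
  shows "let S_UU = UU_run r (2 * a + 1) (2 * a + 2 * b);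
             S_DD = DD_run r (2 * a + 1) (2 * a + 2 * b)
         in (\<not> constant_run (run r (a + 1) (a + b)) \<longrightarrow>
               S_UU \<noteq> [] \<and> S_DD \<noteq> [] \<and>
               balanced_in V4 V5 S_UU \<and> balanced_in V4 V5 S_DD \<and>
               length S_UU + length S_DD = 2 * b) \<and>
            (constant_run (run r (a + 1) (a + b)) \<longrightarrow>
               (S_UU \<noteq> [] \<and> S_DD = [] \<and>
                  balanced_in V4 V5 S_UU \<and> length S_UU = 2 * b) \<or>
               (S_UU = [] \<and> S_DD \<noteq> [] \<and>
                  balanced_in V4 V5 S_DD \<and> length S_DD = 2 * b))"
proof -
  define UUs where "UUs = UU_run r (2 * a + 1) (2 * a + 2 * b)"
  define DDs where "DDs = DD_run r (2 * a + 1) (2 * a + 2 * b)"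
  have states: "\<forall>j\<ge>1. r j \<in> {1, 2}"
    using assms(1) by (simp add: balanced_rotor_type_def two_state_rotor_type_def)
  \<comment> \<open>Joining the two balanced runs gives a balanced prefix, so the visit counts are
    known at both ends of the block of particles.\<close>
  have "balanced_in 1 2 (run r 1 (2 * (a + b)))"
    using assms(3,4) card_Collect_atLeastAtMost_append[of "2 * a" "2 * (a + b)"]
    by (simp add: balanced_in_def count_list_run)
  then have visits: "visits r s (2 * a) = a" "visits r s (2 * a + 2 * b) = a + b" for s
    using balanced_imp_visits[OF states] assms(3) by (metis, metis distrib_left)
  have runs: "UUs = hitting_run U r (Suc (2 * a)) (2 * a + 2 * b)"
      "DDs = hitting_run D r (Suc (2 * a)) (2 * a + 2 * b)"
    by (simp_all add: UUs_def DDs_def UU_run_def DD_run_def UU_def DD_def hitting_run_def)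
  have balanced: "balanced_in V4 V5 UUs" "balanced_in V4 V5 DDs"
    unfolding runs by (rule hitting_run_balanced(1)[OF assms(1) _ visits], simp)+
  \<comment> \<open>\<open>?A\<close> holds the exit terms for \<open>U\<close> and
    \<open>?B\<close> those for \<open>D\<close>. They partition the window, whence the lengths add
    to \<open>2 * b\<close>.\<close>
  let ?A = "{i \<in> {a + 1..a + b}. r i \<noteq> 1}" and ?B = "{i \<in> {a + 1..a + b}. r i = 1}"
  have length: "length UUs = 2 * card ?A" "length DDs = 2 * card ?B"
    unfolding runs
    by (simp_all add: hitting_run_balanced(2)[OF assms(1) _ visits] exits_def)
  have "card ?A + card ?B = card (?A \<union> ?B)"
    by (subst card_Un_disjoint) auto
  also have "?A \<union> ?B = {a + 1..a + b}" by auto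
  finally have total: "card ?A + card ?B = b" by simp
  have "constant_run (run r (a + 1) (a + b)) \<longleftrightarrow> (\<forall>i\<in>{a + 1..a + b}. \<forall>j\<in>{a + 1..a + b}. r i = r j)"
    by (simp add: constant_run_def run_def atLeastLessThanSuc_atLeastAtMost del: upt_Suc)
  also have "\<dots> \<longleftrightarrow> ?A = {} \<or> ?B = {}"
  proof
    assume "?A = {} \<or> ?B = {}"
    moreover have "r i = 1 \<or> r i = 2" if "i \<in> {a + 1..a + b}" for i
      using states[rule_format, of i] that by auto
    ultimately consider "\<forall>i\<in>{a + 1..a + b}. r i = 1" | "\<forall>i\<in>{a + 1..a + b}. r i = 2"
      by blast
    then show "\<forall>i\<in>{a + 1..a + b}. \<forall>j\<in>{a + 1..a + b}. r i = r j"
      by cases simp_all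
  next
    assume eq: "\<forall>i\<in>{a + 1..a + b}. \<forall>j\<in>{a + 1..a + b}. r i = r j"
    show "?A = {} \<or> ?B = {}"
    proof (rule ccontr)
      assume "\<not> (?A = {} \<or> ?B = {})"
      then obtain i j where "i \<in> ?A" "j \<in> ?B" by blast
      with eq[rule_format, of i j] show False by simp
    qed
  qed
  also have "\<dots> \<longleftrightarrow> card ?A = 0 \<or> card ?B = 0"
    by (simp only: card_eq_0_iff) simp
  finally have const_iff: "constant_run (run r (a + 1) (a + b)) \<longleftrightarrow> length UUs = 0 \<or> length DDs = 0"
    by (simp only: length mult_eq_0_iff) simp
  have sum: "length UUs + length DDs = 2 * b" using length total by simp
  \<comment> \<open>Since \<open>b \<ge> 1\<close>, the two lengths cannot both vanish; in the
    constant case exactly one does and the other equals \<open>2 * b\<close>.\<close>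
  then show ?thesis
    using balanced assms(2) const_iff
    unfolding UUs_def[symmetric] DDs_def[symmetric] Let_def length_0_conv[symmetric] by auto
qed

end
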